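(* Let $\ell$ be a convex differentiable function on $\mathcal{X}$ such that, for constants $K,L\ge 0$, $\|\nabla\ell(x)\|\le K$ for all $x\in\mathcal{X}$ and $\|\nabla\ell(x)-\nabla\ell(y)\|\le L\|x-y\|_*$ for all $x,y\in\mathcal{X}$. Then there is a constant $\tilde C\ge 0$ (independent of $t$ and of the iterates) such that for every sequence of iterates $x_1,x_2,\dots\in\mathcal{X}$, with $s_t=\langle\nabla\ell(x_t),x_t\rangle u-\nabla\ell(x_t)$ and predictions $m_t=s_{t-1}$, one has for all $t\ge 2$ $$\|s_t-m_t\|^2\le\tilde C\,\|x_t-x_{t-1}\|_*^2 .$$
   Context: $\mathcal{X}\subset\mathbb{R}^d$ is a nonempty convex compact set, and $u\in\mathbb{R}^d$ is a vector with $\langle u,x\rangle=1$ for all $x\in\mathcal{X}$. $\|\cdot\|$ is a norm on $\mathbb{R}^d$ with dual norm $\|x\|_*=\sup\{\langle x,y\rangle:\|y\|\le 1\}$. Differentiability of $\ell$ on $\mathcal{X}$ means that $\ell$ is defined and differentiable on an open neighbourhood of $\mathcal{X}$. The vector $s_t$ is the change in the regret vector in round $t$ of online convex optimization with the fixed loss $\ell$ in every round, linearized by the gradient at $x_t$. *)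

theory Defs
  imports "HOL-Analysis.Analysis"
begin

text \<open>
  The norm of the statement is an arbitrary norm on the space, unrelated to the Euclidean norm
  that the type class provides as \<^const>\<open>norm\<close>.
\<close>

definition is_norm :: "('a::real_vector \<Rightarrow> real) \<Rightarrow> bool" where
  "is_norm N \<longleftrightarrow>
     (\<forall>x. 0 \<le> N x) \<and>
     (\<forall>x. N x = 0 \<longleftrightarrow> x = 0) \<and>
     (\<forall>c x. N (c *\<^sub>R x) = \<bar>c\<bar> * N x) \<and>
     (\<forall>x y. N (x + y) \<le> N x + N y)"

text \<open>
  The supremum is taken in the reals, so it is the intended value only when the set is bounded
  above; for a norm on a finite-dimensional space this is always the case.
\<close>

definition dual_norm :: "('a::real_inner \<Rightarrow> real) \<Rightarrow> 'a \<Rightarrow> real" where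
  "dual_norm N x = Sup {x \<bullet> y |y. N y \<le> 1}"

definition gradient :: "('a::real_inner \<Rightarrow> real) \<Rightarrow> 'a \<Rightarrow> 'a" where
  "gradient f x = (THE g. GDERIV f x :> g)"

lemma gradient_eqI:
  assumes "GDERIV f x :> g"
  shows "gradient f x = g"
  unfolding gradient_def
proof (rule the_equality)
  show "GDERIV f x :> g" by fact
next
  fix h assume "GDERIV f x :> h"
  then have "(\<lambda>k. k \<bullet> h) = (\<lambda>k. k \<bullet> g)"
    using has_derivative_unique assms unfolding gderiv_def by blast
  then have "\<forall>k. k \<bullet> h = k \<bullet> g"
    by (simp add: fun_eq_iff)
  then show "h = g"
    by (simp only: vector_eq_ldot)
qed

lemma GDERIV_gradient:
  fixes f :: "'a::euclidean_space \<Rightarrow> real"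
  assumes "f differentiable (at x)"
  shows "GDERIV f x :> gradient f x"
proof -
  obtain D where D: "(f has_derivative D) (at x)"
    using assms unfolding differentiable_def by blast
  then have "linear D"
    by (rule has_derivative_linear)
  then have "\<exists>g. D = (\<lambda>h. h \<bullet> g)"
    by (intro exI[of _ "adjoint D 1"]) (simp add: fun_eq_iff adjoint_works)
  with D obtain g where "GDERIV f x :> g"
    unfolding gderiv_def by blast
  then show ?thesis
    by (simp only: gradient_eqI)
qed

definition differentiable_near :: "('a::real_normed_vector \<Rightarrow> real) \<Rightarrow> 'a set \<Rightarrow> bool" where
  "differentiable_near f X \<longleftrightarrow> (\<exists>U. open U \<and> X \<subseteq> U \<and> (\<forall>x\<in>U. f differentiable (at x)))"

end

(* Split <a, x> - <b, y> = <a - b, x> + <b, x - y> for the gradients a, b at x, y, and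
   apply Hoelder's inequality to both terms. Compactness of X bounds the dual norm of x, so
   s_t is a Lipschitz function of x_t. *)
theory Submission
  imports Defs
begin

lemma is_norm_nonneg: "is_norm N \<Longrightarrow> 0 \<le> N x"
  and is_norm_eq_0: "is_norm N \<Longrightarrow> N x = 0 \<longleftrightarrow> x = 0"
  and is_norm_scale: "is_norm N \<Longrightarrow> N (c *\<^sub>R x) = \<bar>c\<bar> * N x"
  and is_norm_triangle: "is_norm N \<Longrightarrow> N (x + y) \<le> N x + N y"
  by (simp_all add: is_norm_def)

lemma is_norm_minus: "is_norm N \<Longrightarrow> N (- x) = N x"
  using is_norm_scale[of N "-1" x] by simp

lemma is_norm_triangle_diff: "is_norm N \<Longrightarrow> N (x - y) \<le> N x + N y"
  using is_norm_triangle[of N x "- y"] by (simp add: is_norm_minus)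

text \<open>Convexity is the route to continuity of \<open>N\<close>: a real-valued convex function
  on an open set of a finite-dimensional space is continuous.\<close>

lemma is_norm_convex_on:
  assumes "is_norm N"
  shows "convex_on UNIV N"
proof (rule convex_onI)
  fix t x y assume "(0::real) < t" "t < 1"
  then show "N ((1 - t) *\<^sub>R x + t *\<^sub>R y) \<le> (1 - t) * N x + t * N y"
    using is_norm_triangle[OF assms, of "(1 - t) *\<^sub>R x" "t *\<^sub>R y"]
    by (simp add: is_norm_scale[OF assms])
qed simp

text \<open>One half of the equivalence of norms in finite dimension. By compactness the continuous
  \<open>N\<close> attains its minimum on the Euclidean unit sphere; this minimum is positive, and
  its inverse serves as \<open>c\<close> by homogeneity.\<close>

lemma is_norm_dominates_norm:
  fixes N :: "'a::euclidean_space \<Rightarrow> real"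
  assumes N: "is_norm N"
  obtains c where "0 < c" and "\<And>x. norm x \<le> c * N x"
proof -
  have "continuous_on (sphere 0 1) N"
    using convex_on_continuous[OF open_UNIV is_norm_convex_on[OF N]]
    by (rule continuous_on_subset) simp
  moreover obtain e :: 'a where "e \<in> Basis"
    using nonempty_Basis by blast
  then have "sphere (0::'a) 1 \<noteq> {}"
    by (metis dist_0_norm mem_sphere norm_Basis empty_iff)
  ultimately obtain z where z: "norm z = 1" and min: "\<And>y. norm y = 1 \<Longrightarrow> N z \<le> N y"
    using continuous_attains_inf[of "sphere (0::'a) 1" N] by auto
  have pos: "0 < N z"
    using z is_norm_nonneg[OF N, of z] is_norm_eq_0[OF N, of z] by force
  have "norm x \<le> inverse (N z) * N x" for x
  proof (cases "x = 0")
    case True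
    then show ?thesis using is_norm_eq_0[OF N, of 0] by simp
  next
    case False
    then have "N z \<le> N ((1 / norm x) *\<^sub>R x)"
      by (intro min) simp
    with False pos show ?thesis
      by (simp add: is_norm_scale[OF N] field_simps)
  qed
  with pos show thesis
    by (intro that[of "inverse (N z)"]) auto
qed

text \<open>The unit ball of \<open>N\<close> has Euclidean radius at most \<open>c\<close>, so
  Cauchy-Schwarz applies. This makes the supremum in \<open>dual_norm\<close> a genuine one and also
  bounds it by a multiple of the Euclidean norm.\<close>

lemma inner_unit_ball_le:
  fixes N :: "'a::euclidean_space \<Rightarrow> real"
  assumes N: "is_norm N"
  obtains c where "0 < c" and "\<And>x y. N y \<le> 1 \<Longrightarrow> x \<bullet> y \<le> c * norm x"
proof -
  obtain c where c: "0 < c" "\<And>x. norm x \<le> c * N x"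
    using is_norm_dominates_norm[OF N] by metis
  have le: "x \<bullet> y \<le> c * norm x" if "N y \<le> 1" for x y
  proof -
    have "norm y \<le> c"
      using c(2)[of y] mult_left_mono[OF that less_imp_le[OF c(1)]] by linarith
    then have "norm x * norm y \<le> c * norm x"
      by (subst mult.commute) (simp add: mult_right_mono)
    with norm_cauchy_schwarz[of x y] show ?thesis by linarith
  qed
  from c(1) le show thesis
    by (rule that)
qed

lemma inner_le_dual_norm:
  fixes N :: "'a::euclidean_space \<Rightarrow> real"
  assumes "is_norm N" and "N y \<le> 1"
  shows "x \<bullet> y \<le> dual_norm N x"
proof -
  obtain c where "0 < c" and "\<And>x y. N y \<le> 1 \<Longrightarrow> x \<bullet> y \<le> c * norm x"
    by (rule inner_unit_ball_le[OF assms(1)]) blast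
  then have "bdd_above {x \<bullet> y |y. N y \<le> 1}"
    by (auto intro!: bdd_aboveI[of _ "c * norm x"])
  with assms(2) show ?thesis
    unfolding dual_norm_def by (intro cSup_upper) blast+
qed

lemma dual_norm_nonneg:
  fixes N :: "'a::euclidean_space \<Rightarrow> real"
  assumes "is_norm N"
  shows "0 \<le> dual_norm N x"
  using inner_le_dual_norm[OF assms, of 0 x] is_norm_eq_0[OF assms, of 0] by simp

text \<open>Scaling a nonzero \<open>v\<close> to \<open>N\<close>-length 1 turns it into a
  competitor in the supremum that defines \<open>dual_norm N w\<close>.\<close>

lemma Hoelder_inner:
  fixes N :: "'a::euclidean_space \<Rightarrow> real"
  assumes N: "is_norm N"
  shows "\<bar>v \<bullet> w\<bar> \<le> N v * dual_norm N w"
proof -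
  \<comment> \<open>Stated for every \<open>v\<close>, so that using it at both \<open>v\<close> and
    \<open>- v\<close> yields the absolute value.\<close>
  have "v \<bullet> w \<le> N v * dual_norm N w" for v
  proof (cases "v = 0")
    case True
    then show ?thesis using is_norm_eq_0[OF N, of 0] by simp
  next
    case False
    then have pos: "0 < N v"
      using is_norm_nonneg[OF N, of v] is_norm_eq_0[OF N, of v] by linarith
    then have "w \<bullet> ((1 / N v) *\<^sub>R v) \<le> dual_norm N w"
      by (intro inner_le_dual_norm[OF N]) (simp add: is_norm_scale[OF N])
    with pos show ?thesis
      by (simp add: field_simps inner_commute)
  qed
  from this[of v] this[of "- v"] show ?thesis
    by (simp add: is_norm_minus[OF N] abs_le_iff)
qed

lemma bounded_dual_norm_le:
  fixes N :: "'a::euclidean_space \<Rightarrow> real"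
  assumes "is_norm N" and "bounded X"
  obtains D where "0 < D" and "\<And>x. x \<in> X \<Longrightarrow> dual_norm N x \<le> D"
proof -
  obtain c where c: "0 < c" "\<And>x y. N y \<le> 1 \<Longrightarrow> x \<bullet> y \<le> c * norm x"
    by (rule inner_unit_ball_le[OF assms(1)]) blast
  obtain b where b: "0 < b" "\<And>x. x \<in> X \<Longrightarrow> norm x \<le> b"
    using assms(2) unfolding bounded_pos by blast
  \<comment> \<open>The vector 0 shows that the set under the supremum is nonempty, as
    \<open>cSup_least\<close> requires.\<close>
  have "N 0 \<le> 1"
    using is_norm_eq_0[OF assms(1), of 0] by simp
  then have "dual_norm N x \<le> c * norm x" for x
    unfolding dual_norm_def using c(2) by (intro cSup_least) blast+
  then have "dual_norm N x \<le> c * b" if "x \<in> X" for x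
    using mult_left_mono[OF b(2)[OF that] less_imp_le[OF c(1)]] by (rule order_trans)
  with c(1) b(1) show thesis
    by (intro that[of "c * b"]) auto
qed

text \<open>Here \<open>a\<close> and \<open>b\<close> stand for the gradients at \<open>x\<close>
  and \<open>y\<close>. In the constant, \<open>L * D + K\<close> bounds the variation of the scalar
  coefficient of \<open>u\<close>, and the last \<open>L\<close> that of the gradient itself. The
  split is asymmetric: a bound is asked of the dual norm at \<open>x\<close> and of the gradient at
  \<open>y\<close>.\<close>

lemma regret_change_Lipschitz:
  fixes N :: "'a::euclidean_space \<Rightarrow> real"
  assumes N: "is_norm N" and "0 \<le> L"
    and D: "dual_norm N x \<le> D" and K: "N b \<le> K"
    and L: "N (a - b) \<le> L * dual_norm N (x - y)"
  shows "N (((a \<bullet> x) *\<^sub>R u - a) - ((b \<bullet> y) *\<^sub>R u - b))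
           \<le> ((L * D + K) * N u + L) * dual_norm N (x - y)"
proof -
  let ?d = "dual_norm N (x - y)"
  have d: "0 \<le> ?d"
    by (rule dual_norm_nonneg[OF N])
  have "N (a - b) * dual_norm N x \<le> (L * ?d) * D"
    using L D d \<open>0 \<le> L\<close> by (intro mult_mono) (auto intro: dual_norm_nonneg[OF N])
  moreover have "N b * ?d \<le> K * ?d"
    using K d by (rule mult_right_mono)
  moreover have "a \<bullet> x - b \<bullet> y = (a - b) \<bullet> x + b \<bullet> (x - y)"
    by (simp add: inner_diff_left inner_diff_right)
  ultimately have "\<bar>a \<bullet> x - b \<bullet> y\<bar> \<le> (L * D + K) * ?d"
    using Hoelder_inner[OF N, of "a - b" x] Hoelder_inner[OF N, of b "x - y"]
    by (simp add: algebra_simps)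
  then have "\<bar>a \<bullet> x - b \<bullet> y\<bar> * N u \<le> (L * D + K) * ?d * N u"
    by (rule mult_right_mono) (rule is_norm_nonneg[OF N])
  moreover have "N ((a \<bullet> x - b \<bullet> y) *\<^sub>R u - (a - b)) \<le> \<bar>a \<bullet> x - b \<bullet> y\<bar> * N u + N (a - b)"
    using is_norm_triangle_diff[OF N, of "(a \<bullet> x - b \<bullet> y) *\<^sub>R u" "a - b"]
    by (simp only: is_norm_scale[OF N])
  moreover have eq: "((a \<bullet> x) *\<^sub>R u - a) - ((b \<bullet> y) *\<^sub>R u - b) = (a \<bullet> x - b \<bullet> y) *\<^sub>R u - (a - b)"
    by (simp add: algebra_simps)
  moreover have "((L * D + K) * N u + L) * ?d = (L * D + K) * ?d * N u + L * ?d"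
    by (simp add: algebra_simps)
  ultimately show ?thesis
    unfolding eq using L by linarith
qed

theorem mainTheorem3:
  fixes X :: "(real ^ 'd) set"
    and u :: "real ^ 'd"
    and N :: "real ^ 'd \<Rightarrow> real"
    and l :: "real ^ 'd \<Rightarrow> real"
    and K L :: real
  assumes "X \<noteq> {}" and "convex X" and "compact X"
    and "\<forall>x\<in>X. u \<bullet> x = 1"
    and "is_norm N"
    and "convex_on X l" and "differentiable_near l X"
    and "0 \<le> K" and "0 \<le> L"
    and "\<forall>x\<in>X. N (gradient l x) \<le> K"
    and "\<forall>x\<in>X. \<forall>y\<in>X. N (gradient l x - gradient l y) \<le> L * dual_norm N (x - y)"
  shows "\<exists>C\<ge>0. \<forall>x s m :: nat \<Rightarrow> real ^ 'd.
           (\<forall>t\<ge>1. x t \<in> X) \<longrightarrow>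
           (\<forall>t\<ge>1. s t = (gradient l (x t) \<bullet> x t) *\<^sub>R u - gradient l (x t)) \<longrightarrow>
           (\<forall>t\<ge>2. m t = s (t - 1)) \<longrightarrow>
           (\<forall>t\<ge>2. (N (s t - m t))\<^sup>2 \<le> C * (dual_norm N (x t - x (t - 1)))\<^sup>2)"
proof -
  note N = \<open>is_norm N\<close>
  obtain D where D: "\<And>x. x \<in> X \<Longrightarrow> dual_norm N x \<le> D"
    using bounded_dual_norm_le[OF N compact_imp_bounded[OF \<open>compact X\<close>]] by metis
  \<comment> \<open>Fixed before any iterates are introduced: only \<open>X\<close>,
    \<open>N\<close>, \<open>u\<close>, \<open>K\<close> and \<open>L\<close> enter, with
    \<open>D\<close> obtained from \<open>X\<close> and \<open>N\<close>. Its square is the witness,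
    hence nonnegative whatever the sign of \<open>?c\<close>.\<close>
  let ?c = "(L * D + K) * N u + L"
  show ?thesis
  proof (intro exI[of _ "?c\<^sup>2"] conjI allI impI)
    fix x s m :: "nat \<Rightarrow> real ^ 'd" and t :: nat
    assume x: "\<forall>t\<ge>1. x t \<in> X"
      and s: "\<forall>t\<ge>1. s t = (gradient l (x t) \<bullet> x t) *\<^sub>R u - gradient l (x t)"
      and m: "\<forall>t\<ge>2. m t = s (t - 1)" and t: "2 \<le> t"
    \<comment> \<open>Since \<open>t\<close> is at least 2, the index \<open>t - 1\<close> is at
      least 1, so both membership and the formula for \<open>s\<close> are available there.\<close>
    have X: "x t \<in> X" "x (t - 1) \<in> X"
      using x t by auto
    have "N (s t - m t) \<le> ?c * dual_norm N (x t - x (t - 1))"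
      using regret_change_Lipschitz[OF N \<open>0 \<le> L\<close> D[OF X(1)],
          of "gradient l (x (t - 1))" K "gradient l (x t)" "x (t - 1)" u]
        assms(10,11) X s m t by simp
    \<comment> \<open>Squaring preserves the inequality because its left-hand side is
      nonnegative.\<close>
    then have "(N (s t - m t))\<^sup>2 \<le> (?c * dual_norm N (x t - x (t - 1)))\<^sup>2"
      by (rule power_mono) (rule is_norm_nonneg[OF N])
    then show "(N (s t - m t))\<^sup>2 \<le> ?c\<^sup>2 * (dual_norm N (x t - x (t - 1)))\<^sup>2"
      by (simp add: power_mult_distrib)
  qed simp
qed

end
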